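(* Let $R$ be a representation of $\mathbf{Q}$ with dimension vector $(1,4,1)$ that is globally injective and globally surjective (i.e. $R$ gives a point of $\mathcal{I}(1)$). Then the dimension vectors of the nonzero proper subrepresentations of $R$ are exactly $(0,b,1)$ for $b\in\{0,1,2,3,4\}$.
   Context: The quiver $\mathbf{Q}$ has vertices $-1,0,1$, arrows $\eta_0,\dots,\eta_3:-1\to0$, $\phi_0,\dots,\phi_3:0\to1$ and relations $\phi_i\eta_j+\phi_j\eta_i=0$; a representation consists of vector spaces $V_{-1},V_0,V_1$ and linear maps $f_i:V_{-1}\to V_0$, $g_i:V_0\to V_1$ with $g_if_j+g_jf_i=0$. $R$ is globally injective (resp. surjective) if $\sum\lambda_if_i$ is injective (resp. $\sum\lambda_ig_i$ surjective) for all $\lambda\in\mathbb{C}^4\setminus\{0\}$. $\mathcal{I}(1)$ denotes the set of classes of such globally injective and globally surjective representations of dimension vector $(1,4,1)$, which correspond to locally free rank 2 instanton sheaves of charge 1 on $\mathbb{P}^3$. *)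

theory Defs
  imports "HOL-Analysis.Analysis"
begin

text \<open>A representation of Q with dimension vector (1,4,1) over the complex numbers:
  V_{-1} = complex (one-dimensional), V_0 = complex^4, V_1 = complex.
  The arrows are indexed by the 4-element type 4.
  f i : V_{-1} -> V_0 and g i : V_0 -> V_1 are complex-linear maps.\<close>

definition is_rep_141 ::
  "(4 \<Rightarrow> complex \<Rightarrow> complex^4) \<Rightarrow> (4 \<Rightarrow> complex^4 \<Rightarrow> complex) \<Rightarrow> bool" where
  "is_rep_141 f g \<longleftrightarrow>
     (\<forall>i. Vector_Spaces.linear (*) (*s) (f i)) \<and>
     (\<forall>i. Vector_Spaces.linear (*s) (*) (g i)) \<and>
     (\<forall>i j x. g i (f j x) + g j (f i x) = 0)"

definition globally_injective ::
  "(4 \<Rightarrow> complex \<Rightarrow> complex^4) \<Rightarrow> bool" where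
  "globally_injective f \<longleftrightarrow>
     (\<forall>c::complex^4. c \<noteq> 0 \<longrightarrow> inj (\<lambda>x. \<Sum>i\<in>UNIV. c$i *s f i x))"

definition globally_surjective ::
  "(4 \<Rightarrow> complex^4 \<Rightarrow> complex) \<Rightarrow> bool" where
  "globally_surjective g \<longleftrightarrow>
     (\<forall>c::complex^4. c \<noteq> 0 \<longrightarrow> surj (\<lambda>y. \<Sum>i\<in>UNIV. c$i * g i y))"

text \<open>Subrepresentation (W_{-1}, W_0, W_1): complex subspaces stable under all arrows.\<close>

definition is_subrep ::
  "(4 \<Rightarrow> complex \<Rightarrow> complex^4) \<Rightarrow> (4 \<Rightarrow> complex^4 \<Rightarrow> complex) \<Rightarrow>
   complex set \<Rightarrow> (complex^4) set \<Rightarrow> complex set \<Rightarrow> bool" where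
  "is_subrep f g W V U \<longleftrightarrow>
     vector_space_over_itself.subspace W \<and> vec.subspace V \<and>
     vector_space_over_itself.subspace U \<and>
     (\<forall>i. \<forall>x\<in>W. f i x \<in> V) \<and> (\<forall>i. \<forall>y\<in>V. g i y \<in> U)"

definition dimvec :: "complex set \<Rightarrow> (complex^4) set \<Rightarrow> complex set \<Rightarrow> nat \<times> nat \<times> nat" where
  "dimvec W V U = (vector_space_over_itself.dim W, vec.dim V, vector_space_over_itself.dim U)"

end

theory Submission
  imports Defs
begin

(* Linearity makes f_i the map x \<mapsto> x f_i(1), and global injectivity says that
  c \<mapsto> \<Sum> c_i f_i(1) has trivial kernel, so the vectors f_i(1) form a basis of V_0.
  Summing the relations g_i f_j + g_j f_i = 0 with coefficients gives g_c f_d = - g_d f_c for the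
  pencils f_c = \<Sum> c_i f_i and g_c = \<Sum> c_i g_i. Hence the g_i have no common kernel: if they
  all vanish on y = f_c(1) with c \<noteq> 0, global surjectivity gives z = f_d(1) with g_c(z) = 1,
  and then 1 = g_c(f_d 1) = - g_d(f_c 1) = 0.
  In a subrepresentation (W, V, U) both W and U are 0 or the whole line. If W is the line then V
  contains the basis f_i(1), so V = V_0 and U = V_1 by the kernel statement; if U = 0 then V lies
  in the common kernel, so V = 0 = W. Thus the nonzero proper subrepresentations are exactly the
  triples (0, V, V_1), and V may be any subspace of V_0. *)

definition pencil_f :: "('i::finite \<Rightarrow> 'x \<Rightarrow> 'a::field^'n) \<Rightarrow> 'a^'i \<Rightarrow> 'x \<Rightarrow> 'a^'n" where
  "pencil_f f c x = (\<Sum>i\<in>UNIV. c$i *s f i x)"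

definition pencil_g :: "('i::finite \<Rightarrow> 'y \<Rightarrow> 'a::field) \<Rightarrow> 'a^'i \<Rightarrow> 'y \<Rightarrow> 'a" where
  "pencil_g g c y = (\<Sum>i\<in>UNIV. c$i * g i y)"

lemma subspace_of_field_cases:
  fixes S :: "'a::field set"
  assumes "vector_space_over_itself.subspace S"
  shows "S = {0} \<or> S = UNIV"
proof (cases "\<exists>x\<in>S. x \<noteq> 0")
  case True
  then obtain x where "x \<in> S" "x \<noteq> 0" by blast
  then have "(y / x) * x \<in> S" for y
    using assms vector_space_over_itself.subspace_scale by blast
  with \<open>x \<noteq> 0\<close> have "S = UNIV" by auto
  then show ?thesis ..
next
  case False
  then show ?thesis using vector_space_over_itself.subspace_0[OF assms] by blast
qed

lemma linear_pencil_f_coeffs: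
  "Vector_Spaces.linear (*s) (*s) (\<lambda>c. pencil_f f c x)"
  unfolding pencil_f_def linear_iff_module_hom module_hom_iff
  by (auto simp: vec.module_axioms sum.distrib vector_sadd_rdistrib
      vector_smult_assoc vec.scale_sum_right)

lemma pencil_f_zero_coeffs [simp]: "pencil_f f 0 x = 0"
  by (simp add: pencil_f_def)

lemma pencil_f_zero:
  assumes "\<And>i. Vector_Spaces.linear (*) (*s) (f i)"
  shows "pencil_f f c 0 = 0"
proof -
  have hom: "module_hom (*) (*s) (f i)" for i
    using assms by (simp add: linear_iff_module_hom)
  show ?thesis
    by (simp add: pencil_f_def module_hom.zero[OF hom])
qed

lemma pencil_g_pencil_f:
  assumes "\<And>i. Vector_Spaces.linear (*s) (*) (g i)"
  shows "pencil_g g c (pencil_f f d x) = (\<Sum>i\<in>UNIV. \<Sum>j\<in>UNIV. c$i * d$j * g i (f j x))"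
proof -
  have hom: "module_hom (*s) (*) (g i)" for i
    using assms by (simp add: linear_iff_module_hom)
  show ?thesis
    unfolding pencil_g_def pencil_f_def
    by (simp add: module_hom.sum[OF hom] module_hom.scale[OF hom] sum_distrib_left mult.assoc)
qed

lemma pencil_relation:
  assumes "is_rep_141 f g"
  shows "pencil_g g c (pencil_f f d x) + pencil_g g d (pencil_f f c x) = 0"
proof -
  have lin: "\<And>i. Vector_Spaces.linear (*s) (*) (g i)"
    and rel: "\<And>i j. g i (f j x) + g j (f i x) = 0"
    using assms unfolding is_rep_141_def by blast+
  have "pencil_g g c (pencil_f f d x) + pencil_g g d (pencil_f f c x)
      = (\<Sum>i\<in>UNIV. \<Sum>j\<in>UNIV. c$i * d$j * g i (f j x))
        + (\<Sum>j\<in>UNIV. \<Sum>i\<in>UNIV. d$j * c$i * g j (f i x))"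
    by (simp add: pencil_g_pencil_f[OF lin])
  also have "\<dots> = (\<Sum>i\<in>UNIV. \<Sum>j\<in>UNIV. c$i * d$j * (g i (f j x) + g j (f i x)))"
    by (subst sum.swap[of _ UNIV]) (simp add: sum.distrib[symmetric] algebra_simps)
  also have "\<dots> = 0"
    by (simp add: rel)
  finally show ?thesis .
qed

lemma surj_pencil_f_one:
  assumes "is_rep_141 f g" and "globally_injective f"
  shows "surj (\<lambda>c. pencil_f f c 1)"
proof -
  have "pencil_f f c 1 \<noteq> 0" if "c \<noteq> 0" for c
  proof
    assume "pencil_f f c 1 = 0"
    moreover have "pencil_f f c 0 = 0"
      using assms(1) by (intro pencil_f_zero) (simp add: is_rep_141_def)
    moreover have "inj (pencil_f f c)"
      using assms(2) that unfolding globally_injective_def pencil_f_def[abs_def] by blast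
    ultimately show False
      by (metis injD zero_neq_one)
  qed
  then have "inj (\<lambda>c. pencil_f f c 1)"
    by (auto simp: vec.linear_inj_iff_eq_0[OF linear_pencil_f_coeffs])
  then show ?thesis
    by (rule vec.linear_inj_imp_surj[OF linear_pencil_f_coeffs])
qed

lemma is_subrep_zero_UNIV:
  assumes "is_rep_141 f g" and "vec.subspace V"
  shows "is_subrep f g {0} V UNIV"
proof -
  have "module_hom (*) (*s) (f i)" for i
    using assms(1) by (simp add: is_rep_141_def linear_iff_module_hom)
  then have "f i 0 = 0" for i
    by (rule module_hom.zero)
  then show ?thesis
    using assms(2) by (simp add: is_subrep_def vec.subspace_0)
qed

lemma obtain_subspace_with_dim:
  assumes "b \<le> CARD('n)"
  obtains V :: "('a::field^'n) set" where "vec.subspace V" and "vec.dim V = b"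
  using vec.choose_subspace_of_subspace[of b UNIV] assms by (auto simp: card_cart_basis)

locale instanton_rep =
  fixes f :: "4 \<Rightarrow> complex \<Rightarrow> complex^4" and g :: "4 \<Rightarrow> complex^4 \<Rightarrow> complex"
  assumes rep: "is_rep_141 f g"
    and glob_inj: "globally_injective f"
    and glob_surj: "globally_surjective g"
begin

lemma common_kernel_trivial:
  assumes "\<And>i. g i y = 0"
  shows "y = 0"
proof -
  obtain c where y: "y = pencil_f f c 1"
    using surj_pencil_f_one[OF rep glob_inj] by (rule surjE)
  show ?thesis
  proof (rule ccontr)
    assume "y \<noteq> 0"
    with y have "c \<noteq> 0" by auto
    then have "surj (pencil_g g c)"
      using glob_surj unfolding globally_surjective_def pencil_g_def[abs_def] by blast
    then obtain z where z: "1 = pencil_g g c z"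
      by (rule surjE)
    obtain d where d: "z = pencil_f f d 1"
      using surj_pencil_f_one[OF rep glob_inj] by (rule surjE)
    have "pencil_g g d y = 0"
      using assms by (simp add: pencil_g_def)
    then have "pencil_g g c z = 0"
      using pencil_relation[OF rep, of c d 1] y d by simp
    with z show False by simp
  qed
qed

lemma subrep_full_if_source_nonzero:
  assumes "is_subrep f g W V U" and "W \<noteq> {0}"
  shows "W = UNIV \<and> V = UNIV \<and> U = UNIV"
proof -
  have sW: "vector_space_over_itself.subspace W" and sV: "vec.subspace V"
    and sU: "vector_space_over_itself.subspace U"
    and fWV: "\<And>i x. x \<in> W \<Longrightarrow> f i x \<in> V" and gVU: "\<And>i y. y \<in> V \<Longrightarrow> g i y \<in> U"
    using assms(1) unfolding is_subrep_def by blast+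
  have W: "W = UNIV"
    using subspace_of_field_cases[OF sW] assms(2) by blast
  have pencil_in_V: "pencil_f f c 1 \<in> V" for c
    unfolding pencil_f_def using W fWV
    by (intro vec.subspace_sum[OF sV] vec.subspace_scale[OF sV]) auto
  have "y \<in> V" for y
  proof -
    obtain c where "y = pencil_f f c 1"
      using surj_pencil_f_one[OF rep glob_inj] by (rule surjE)
    then show ?thesis
      using pencil_in_V by simp
  qed
  then have V: "V = UNIV"
    by blast
  have "(1 :: complex^4) \<noteq> 0"
    by (simp add: vec_eq_iff)
  then obtain i where "g i 1 \<noteq> 0"
    using common_kernel_trivial by meson
  moreover have "g i 1 \<in> U"
    using gVU V by blast
  ultimately have "U = UNIV"
    using subspace_of_field_cases[OF sU] by blast
  with W V show ?thesis by blast
qed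

lemma subrep_zero_if_target_zero:
  assumes "is_subrep f g W V U" and "U = {0}"
  shows "W = {0} \<and> V = {0}"
proof -
  have sV: "vec.subspace V" and gVU: "\<And>i y. y \<in> V \<Longrightarrow> g i y \<in> U"
    using assms(1) unfolding is_subrep_def by blast+
  have "y = 0" if "y \<in> V" for y
    using gVU[OF that] assms(2) by (intro common_kernel_trivial) simp
  then have "V = {0}"
    using vec.subspace_0[OF sV] by blast
  moreover have "W = {0}"
    using subrep_full_if_source_nonzero[OF assms(1)] assms(2) by force
  ultimately show ?thesis by blast
qed

lemma proper_subrep_shape:
  assumes "is_subrep f g W V U"
    and "\<not> (W = {0} \<and> V = {0} \<and> U = {0})" and "\<not> (W = UNIV \<and> V = UNIV \<and> U = UNIV)"
  shows "W = {0} \<and> U = UNIV"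
proof -
  have "W = {0}"
    using assms(3) subrep_full_if_source_nonzero[OF assms(1)] by blast
  moreover have "U \<noteq> {0}"
    using assms(2) subrep_zero_if_target_zero[OF assms(1)] by blast
  moreover have "vector_space_over_itself.subspace U"
    using assms(1) by (simp add: is_subrep_def)
  ultimately show ?thesis
    using subspace_of_field_cases by blast
qed

lemma dimvec_proper_subrep:
  assumes "is_subrep f g W V U"
    and "\<not> (W = {0} \<and> V = {0} \<and> U = {0})" and "\<not> (W = UNIV \<and> V = UNIV \<and> U = UNIV)"
  shows "dimvec W V U \<in> {(0, b, 1) | b. b \<in> {0..4}}"
proof -
  have "dimvec W V U = (0, vec.dim V, 1)"
    using proper_subrep_shape[OF assms] by (simp add: dimvec_def)
  moreover have "vec.dim V \<le> 4"
    using dim_subset_UNIV_cart_gen[of V] by simp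
  ultimately show ?thesis by simp
qed

lemma proper_subrep_with_dimvec:
  assumes "b \<le> 4"
  shows "(0, b, 1) \<in> {dimvec W V U | W V U. is_subrep f g W V U
            \<and> \<not> (W = {0} \<and> V = {0} \<and> U = {0})
            \<and> \<not> (W = UNIV \<and> V = UNIV \<and> U = UNIV)}"
proof -
  obtain V :: "(complex^4) set" where "vec.subspace V" and "vec.dim V = b"
    by (rule obtain_subspace_with_dim[where 'n=4]) (use assms in simp)
  moreover have "(UNIV :: complex set) \<noteq> {0}"
    by (metis UNIV_I singletonD zero_neq_one)
  ultimately show ?thesis
    using is_subrep_zero_UNIV[OF rep]
    by (intro CollectI exI[of _ "{0}"] exI[of _ V] exI[of _ UNIV]) (auto simp: dimvec_def)
qed

end

theorem mainTheorem10:
  fixes f :: "4 \<Rightarrow> complex \<Rightarrow> complex^4" and g :: "4 \<Rightarrow> complex^4 \<Rightarrow> complex"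
  assumes "is_rep_141 f g" and "globally_injective f" and "globally_surjective g"
  shows "{dimvec W V U | W V U. is_subrep f g W V U
            \<and> \<not> (W = {0} \<and> V = {0} \<and> U = {0})
            \<and> \<not> (W = UNIV \<and> V = UNIV \<and> U = UNIV)}
         = {(0, b, 1) | b. b \<in> {0..4}}"
proof -
  interpret instanton_rep f g
    using assms by unfold_locales
  show ?thesis
  proof (intro set_eqI iffI)
    fix t :: "nat \<times> nat \<times> nat"
    assume "t \<in> {dimvec W V U | W V U. is_subrep f g W V U
            \<and> \<not> (W = {0} \<and> V = {0} \<and> U = {0})
            \<and> \<not> (W = UNIV \<and> V = UNIV \<and> U = UNIV)}"
    then show "t \<in> {(0, b, 1) | b. b \<in> {0..4}}"
      using dimvec_proper_subrep by blast
  next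
    fix t :: "nat \<times> nat \<times> nat"
    assume "t \<in> {(0, b, 1) | b. b \<in> {0..4}}"
    then show "t \<in> {dimvec W V U | W V U. is_subrep f g W V U
            \<and> \<not> (W = {0} \<and> V = {0} \<and> U = {0})
            \<and> \<not> (W = UNIV \<and> V = UNIV \<and> U = UNIV)}"
      using proper_subrep_with_dimvec by auto
  qed
qed

end
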